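(* Let $R$ be a finite commutative local ring with identity which is not a field. Then $$\gamma^o(\Gamma(R)) \leq \left(|Z(R)^*| - \gamma^o(\Gamma(R))\right)\left( \gamma^o(\Gamma(R)) -1\right) + 1.$$
   Context: $Z(R)$ denotes the set of zero-divisors of $R$, including $0$, and $Z(R)^*=Z(R)\setminus\{0\}$. The zero-divisor graph $\Gamma(R)$ is the simple graph with vertex set $Z(R)^*$, in which distinct $u,v$ are adjacent if and only if $uv=0$. For a simple graph $\Gamma=(V,E)$, a set $S\subseteq V$ and a vertex $v$, let $\delta_S(v)$ be the number of neighbors of $v$ in $S$ and $\overline{S}=V\setminus S$. A nonempty set $S\subseteq V$ is a global offensive alliance if $\delta_S(v)\geq \delta_{\overline{S}}(v)+1$ for every $v\in\overline{S}$. $\gamma^o(\Gamma)$ is the minimum cardinality of a global offensive alliance of $\Gamma$. *)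

theory Defs
  imports "HOL-Algebra.Ideal"
begin

definition local_ring :: "('a, 'b) ring_scheme \<Rightarrow> bool" where
  "local_ring R \<longleftrightarrow> cring R \<and> (\<exists>!M. maximalideal M R)"

definition zero_divisors :: "('a, 'b) ring_scheme \<Rightarrow> 'a set" where
  "zero_divisors R =
     {x \<in> carrier R. \<exists>y \<in> carrier R. y \<noteq> \<zero>\<^bsub>R\<^esub> \<and> x \<otimes>\<^bsub>R\<^esub> y = \<zero>\<^bsub>R\<^esub>}"

definition nonzero_zero_divisors :: "('a, 'b) ring_scheme \<Rightarrow> 'a set" where
  "nonzero_zero_divisors R = zero_divisors R - {\<zero>\<^bsub>R\<^esub>}"

text \<open>A simple graph is a pair of a vertex set and a set of edges, each edge being a set of
  two distinct vertices.\<close>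

type_synonym 'a sgraph = "'a set \<times> 'a set set"

definition zero_divisor_graph :: "('a, 'b) ring_scheme \<Rightarrow> 'a sgraph" where
  "zero_divisor_graph R =
     (nonzero_zero_divisors R,
      {{u, v} | u v. u \<in> nonzero_zero_divisors R \<and> v \<in> nonzero_zero_divisors R \<and>
                     u \<noteq> v \<and> u \<otimes>\<^bsub>R\<^esub> v = \<zero>\<^bsub>R\<^esub>})"

definition nbr_count :: "'a sgraph \<Rightarrow> 'a set \<Rightarrow> 'a \<Rightarrow> nat" where
  "nbr_count G S v = card {u \<in> S. {u, v} \<in> snd G}"

definition global_offensive_alliance :: "'a sgraph \<Rightarrow> 'a set \<Rightarrow> bool" where
  "global_offensive_alliance G S \<longleftrightarrow>
     S \<noteq> {} \<and> S \<subseteq> fst G \<and>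
     (\<forall>v \<in> fst G - S. nbr_count G S v \<ge> nbr_count G (fst G - S) v + 1)"

text \<open>Meaningful for finite graphs with at least one vertex; the vertex set is then itself a
  global offensive alliance, so the minimum exists.\<close>

definition global_offensive_alliance_number :: "'a sgraph \<Rightarrow> nat" where
  "global_offensive_alliance_number G = Min {card S | S. global_offensive_alliance G S}"

end

theory Submission
  imports Defs
begin

text \<open>Write \<open>n\<close> for the number of vertices and \<open>\<gamma>\<close> for the alliance number, so that
  \<open>1 \<le> \<gamma> \<le> n\<close>. The inequality says \<open>\<gamma> - 1 \<le> (n - \<gamma>) (\<gamma> - 1)\<close> and can only fail if \<open>\<gamma> = n > 1\<close>.
  Removing a vertex that has a neighbour leaves a global offensive alliance, so \<open>\<gamma> < n\<close> as soon as
  there is an edge. Suppose there is none. Then every \<open>x \<in> Z(R)\<^sup>*\<close> is annihilated only by \<open>0\<close> and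
  \<open>x\<close>. For distinct \<open>x, y \<in> Z(R)\<^sup>*\<close> the product \<open>x y\<close> would be nonzero and annihilated by both
  factors, so \<open>x = x y = y\<close>. Hence \<open>n = 1\<close> and the inequality reads \<open>1 \<le> 1\<close>.\<close>

definition independent_set :: "'a sgraph \<Rightarrow> 'a set \<Rightarrow> bool" where
  "independent_set G I \<longleftrightarrow> I \<subseteq> fst G \<and> (\<forall>u \<in> I. \<forall>v \<in> I. {u, v} \<notin> snd G)"

definition isolated_vertex :: "'a sgraph \<Rightarrow> 'a \<Rightarrow> bool" where
  "isolated_vertex G v \<longleftrightarrow> v \<in> fst G \<and> (\<forall>e \<in> snd G. v \<notin> e)"

locale finite_nonempty_sgraph =
  fixes G :: "'a sgraph"
  assumes finite_vertices: "finite (fst G)"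
    and vertices_nonempty: "fst G \<noteq> {}"
    and edge_subset_vertices: "e \<in> snd G \<Longrightarrow> e \<subseteq> fst G"
    and card_edge: "e \<in> snd G \<Longrightarrow> card e = 2"
begin

lemma neighbour_of_nonisolated_vertex:
  assumes "v \<in> fst G" and "\<not> isolated_vertex G v"
  obtains u where "u \<in> fst G" and "{u, v} \<in> snd G"
proof -
  obtain e where e: "e \<in> snd G" "v \<in> e"
    using assms by (auto simp: isolated_vertex_def)
  then obtain u where "e = {v, u}"
    using card_edge by (auto simp: card_2_iff)
  with e show ?thesis
    using edge_subset_vertices by (intro that[of u]) (auto simp: insert_commute)
qed

lemma independent_set_empty: "independent_set G {}"
  by (simp add: independent_set_def)

lemma independent_set_singleton: "v \<in> fst G \<Longrightarrow> independent_set G {v}"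
  using card_edge[of "{v}"] by (auto simp: independent_set_def)

lemma independent_set_neq_vertices:
  assumes "independent_set G I" and "\<And>v. v \<in> I \<Longrightarrow> \<not> isolated_vertex G v"
  shows "I \<noteq> fst G"
proof
  assume "I = fst G"
  moreover obtain v where "v \<in> fst G"
    using vertices_nonempty by blast
  ultimately show False
    using assms neighbour_of_nonisolated_vertex by (metis independent_set_def)
qed

lemma global_offensive_alliance_Diff_independent_set:
  assumes I: "independent_set G I" and nonisolated: "\<And>v. v \<in> I \<Longrightarrow> \<not> isolated_vertex G v"
  shows "global_offensive_alliance G (fst G - I)"
  unfolding global_offensive_alliance_def
proof (intro conjI ballI)
  have I_subset: "I \<subseteq> fst G" and no_edge: "\<And>u v. u \<in> I \<Longrightarrow> v \<in> I \<Longrightarrow> {u, v} \<notin> snd G"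
    using I by (auto simp: independent_set_def)
  show "fst G - I \<noteq> {}"
    using I_subset independent_set_neq_vertices[OF assms] by blast
  show "fst G - I \<subseteq> fst G" by blast
  fix v assume "v \<in> fst G - (fst G - I)"
  then have v: "v \<in> I" "v \<in> fst G" by auto
  obtain u where "u \<in> fst G" "{u, v} \<in> snd G"
    using v nonisolated neighbour_of_nonisolated_vertex by blast
  then have "u \<in> {u \<in> fst G - I. {u, v} \<in> snd G}"
    using no_edge v by blast
  then have "nbr_count G (fst G - I) v \<ge> 1"
    using finite_vertices by (auto simp: nbr_count_def Suc_le_eq card_gt_0_iff)
  moreover have "{u \<in> fst G - (fst G - I). {u, v} \<in> snd G} = {}"
    using no_edge v by auto
  then have "nbr_count G (fst G - (fst G - I)) v = 0"
    unfolding nbr_count_def by (simp only: card.empty)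
  ultimately show "nbr_count G (fst G - (fst G - I)) v + 1 \<le> nbr_count G (fst G - I) v"
    by simp
qed

lemma finite_global_offensive_alliance_cards:
  "finite {card S | S. global_offensive_alliance G S}"
proof (rule finite_subset)
  show "{card S | S. global_offensive_alliance G S} \<subseteq> card ` Pow (fst G)"
    by (auto simp: global_offensive_alliance_def)
qed (use finite_vertices in simp)

lemma global_offensive_alliance_number_le:
  assumes "global_offensive_alliance G S"
  shows "global_offensive_alliance_number G \<le> card S"
  unfolding global_offensive_alliance_number_def
  using assms finite_global_offensive_alliance_cards by (intro Min_le) auto

lemma global_offensive_alliance_number_add_card_independent_set_le:
  assumes "independent_set G I" and "\<And>v. v \<in> I \<Longrightarrow> \<not> isolated_vertex G v"
  shows "global_offensive_alliance_number G + card I \<le> card (fst G)"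
proof -
  have I: "I \<subseteq> fst G"
    using assms(1) by (simp add: independent_set_def)
  have "global_offensive_alliance_number G \<le> card (fst G - I)"
    using assms by (intro global_offensive_alliance_number_le
        global_offensive_alliance_Diff_independent_set)
  also have "card (fst G - I) = card (fst G) - card I"
    using I finite_vertices by (intro card_Diff_subset) (auto intro: finite_subset)
  finally show ?thesis
    using card_mono[OF finite_vertices I] by simp
qed

lemma global_offensive_alliance_number_le_card_vertices:
  "global_offensive_alliance_number G \<le> card (fst G)"
  using global_offensive_alliance_number_add_card_independent_set_le[OF independent_set_empty]
  by simp

lemma global_offensive_alliance_number_less_card_vertices:
  assumes "snd G \<noteq> {}"
  shows "global_offensive_alliance_number G < card (fst G)"
proof -
  obtain e where "e \<in> snd G" using assms by blast
  moreover from this obtain v where "v \<in> e"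
    using card_edge by (fastforce simp: card_2_iff)
  ultimately have "v \<in> fst G" "\<not> isolated_vertex G v"
    using edge_subset_vertices by (auto simp: isolated_vertex_def)
  then show ?thesis
    using global_offensive_alliance_number_add_card_independent_set_le[of "{v}"]
      independent_set_singleton by simp
qed

lemma global_offensive_alliance_number_pos: "global_offensive_alliance_number G > 0"
proof -
  have "global_offensive_alliance G (fst G)"
    using global_offensive_alliance_Diff_independent_set[OF independent_set_empty] by simp
  then have "global_offensive_alliance_number G \<in> {card S | S. global_offensive_alliance G S}"
    unfolding global_offensive_alliance_number_def
    using finite_global_offensive_alliance_cards by (intro Min_in) auto
  then obtain S where "global_offensive_alliance_number G = card S" "S \<noteq> {}" "S \<subseteq> fst G"
    by (auto simp: global_offensive_alliance_def)
  then show ?thesis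
    using finite_vertices by (simp add: card_gt_0_iff finite_subset)
qed

theorem global_offensive_alliance_number_bound:
  assumes "is_singleton (fst G) \<or> snd G \<noteq> {}"
  defines "\<gamma> \<equiv> int (global_offensive_alliance_number G)"
  shows "\<gamma> \<le> (int (card (fst G)) - \<gamma>) * (\<gamma> - 1) + 1"
  using assms(1)
proof
  assume "is_singleton (fst G)"
  then have "\<gamma> = 1"
    using global_offensive_alliance_number_le_card_vertices global_offensive_alliance_number_pos
    by (simp add: \<gamma>_def is_singleton_altdef)
  then show ?thesis by simp
next
  assume "snd G \<noteq> {}"
  then have "1 \<le> int (card (fst G)) - \<gamma>"
    using global_offensive_alliance_number_less_card_vertices by (simp add: \<gamma>_def)
  moreover have "0 \<le> \<gamma> - 1"
    using global_offensive_alliance_number_pos by (simp add: \<gamma>_def)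
  ultimately have "1 * (\<gamma> - 1) \<le> (int (card (fst G)) - \<gamma>) * (\<gamma> - 1)"
    by (rule mult_right_mono)
  then show ?thesis by simp
qed

end

lemma (in domain) finite_carrier_imp_field:
  assumes "finite (carrier R)"
  shows "field R"
proof (rule cring_fieldI2)
  fix x assume x: "x \<in> carrier R" "x \<noteq> \<zero>"
  then have "inj_on ((\<otimes>) x) (carrier R)"
    by (auto intro: inj_onI simp: m_lcancel)
  then have "(\<otimes>) x ` carrier R = carrier R"
    using assms x by (intro endo_inj_surj) auto
  then show "\<exists>y \<in> carrier R. x \<otimes> y = \<one>"
    by (metis imageE one_closed)
qed simp

lemma (in ideal) one_not_zero_if_proper:
  assumes "I \<noteq> carrier R"
  shows "\<one> \<noteq> \<zero>"
  using assms one_imp_carrier additive_subgroup.zero_closed[OF is_additive_subgroup] by metis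

lemma local_ring_one_not_zero:
  fixes R (structure)
  assumes "local_ring R"
  shows "\<one> \<noteq> \<zero>"
proof -
  obtain M where "maximalideal M R"
    using assms by (auto simp: local_ring_def)
  then interpret maximalideal M R .
  show ?thesis
    using I_notcarr one_not_zero_if_proper by blast
qed

lemma fst_zero_divisor_graph [simp]: "fst (zero_divisor_graph R) = nonzero_zero_divisors R"
  by (simp add: zero_divisor_graph_def)

context cring
begin

lemma nonzero_zero_divisorsI:
  assumes "x \<in> carrier R" "y \<in> carrier R" "x \<noteq> \<zero>" "y \<noteq> \<zero>" "x \<otimes> y = \<zero>"
  shows "x \<in> nonzero_zero_divisors R"
  using assms by (auto simp: nonzero_zero_divisors_def zero_divisors_def)

lemma nonzero_zero_divisorsE:
  assumes "x \<in> nonzero_zero_divisors R"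
  obtains y where "x \<in> carrier R" "x \<noteq> \<zero>" "y \<in> nonzero_zero_divisors R" "x \<otimes> y = \<zero>"
proof -
  obtain y where "x \<in> carrier R" "x \<noteq> \<zero>" "y \<in> carrier R" "y \<noteq> \<zero>" "x \<otimes> y = \<zero>"
    using assms by (auto simp: nonzero_zero_divisors_def zero_divisors_def)
  moreover from this have "y \<in> nonzero_zero_divisors R"
    by (intro nonzero_zero_divisorsI[of _ x]) (simp_all add: m_comm)
  ultimately show ?thesis using that by blast
qed

lemma domain_if_no_nonzero_zero_divisors:
  assumes "nonzero_zero_divisors R = {}" and "\<one> \<noteq> \<zero>"
  shows "domain R"
proof
  show "x = \<zero> \<or> y = \<zero>" if "x \<otimes> y = \<zero>" "x \<in> carrier R" "y \<in> carrier R" for x y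
    using that assms(1) nonzero_zero_divisorsI by blast
qed (rule assms(2))

lemma finite_nonempty_sgraph_zero_divisor_graph:
  assumes "finite (carrier R)" and "\<one> \<noteq> \<zero>" and "\<not> field R"
  shows "finite_nonempty_sgraph (zero_divisor_graph R)"
proof
  have "nonzero_zero_divisors R \<subseteq> carrier R"
    by (auto elim: nonzero_zero_divisorsE)
  with assms(1) show "finite (fst (zero_divisor_graph R))"
    by (simp add: finite_subset)
  show "fst (zero_divisor_graph R) \<noteq> {}"
    using assms domain_if_no_nonzero_zero_divisors domain.finite_carrier_imp_field by auto
qed (auto simp: zero_divisor_graph_def)

lemma zero_divisor_graph_edgeI:
  assumes "u \<in> nonzero_zero_divisors R" "v \<in> nonzero_zero_divisors R" "u \<noteq> v" "u \<otimes> v = \<zero>"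
  shows "{u, v} \<in> snd (zero_divisor_graph R)"
  using assms by (auto simp: zero_divisor_graph_def)

lemma square_zero_if_no_edges:
  assumes "snd (zero_divisor_graph R) = {}" and "x \<in> nonzero_zero_divisors R"
  shows "x \<otimes> x = \<zero>"
  using assms zero_divisor_graph_edgeI by (metis empty_iff nonzero_zero_divisorsE)

lemma zero_divisor_graph_has_edge:
  assumes x: "x \<in> nonzero_zero_divisors R" and y: "y \<in> nonzero_zero_divisors R" and "x \<noteq> y"
  shows "snd (zero_divisor_graph R) \<noteq> {}"
proof
  assume no_edges: "snd (zero_divisor_graph R) = {}"
  then have not_adjacent: "u \<otimes> v \<noteq> \<zero>"
    if "u \<in> nonzero_zero_divisors R" "v \<in> nonzero_zero_divisors R" "u \<noteq> v" for u v
    using that zero_divisor_graph_edgeI by blast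
  have carrier: "x \<in> carrier R" "y \<in> carrier R" and "x \<noteq> \<zero>"
    using x y by (auto elim: nonzero_zero_divisorsE)
  have x_kills_xy: "x \<otimes> (x \<otimes> y) = \<zero>"
    using carrier square_zero_if_no_edges[OF no_edges x] by (simp flip: m_assoc)
  have y_kills_xy: "y \<otimes> (x \<otimes> y) = \<zero>"
    using carrier square_zero_if_no_edges[OF no_edges y] by (simp add: m_lcomm)
  have "x \<otimes> y \<in> nonzero_zero_divisors R"
    using carrier \<open>x \<noteq> \<zero>\<close> not_adjacent[OF x y \<open>x \<noteq> y\<close>] x_kills_xy m_comm
    by (intro nonzero_zero_divisorsI[of _ x]) auto
  then have "x = x \<otimes> y" and "y = x \<otimes> y"
    using not_adjacent x y x_kills_xy y_kills_xy by blast+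
  with \<open>x \<noteq> y\<close> show False by simp
qed

end

theorem theorem2p2:
  fixes R :: "('a, 'b) ring_scheme"
  assumes "local_ring R"
    and "finite (carrier R)"
    and "\<not> field R"
  shows "int (global_offensive_alliance_number (zero_divisor_graph R)) \<le>
    (int (card (nonzero_zero_divisors R)) -
       int (global_offensive_alliance_number (zero_divisor_graph R))) *
    (int (global_offensive_alliance_number (zero_divisor_graph R)) - 1) + 1"
proof -
  interpret cring R
    using assms(1) by (simp add: local_ring_def)
  interpret finite_nonempty_sgraph "zero_divisor_graph R"
    using assms local_ring_one_not_zero by (intro finite_nonempty_sgraph_zero_divisor_graph)
  have "is_singleton (nonzero_zero_divisors R) \<or> snd (zero_divisor_graph R) \<noteq> {}"
    using vertices_nonempty zero_divisor_graph_has_edge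
    by (metis fst_zero_divisor_graph is_singletonI')
  then show ?thesis
    using global_offensive_alliance_number_bound by simp
qed

end
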